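(* If $G$ is a graph of order $n$ that belongs to $\mathcal{G}$, then $\iota(G)=n/3$.
   Context: Graphs are finite and simple, considered up to isomorphism; the order of a graph is its number of vertices. $P_k$ and $C_k$ denote the path and cycle of order $k$. For a graph $G=(V,E)$ and $D\subseteq V$, $N[D]$ is the set of vertices that belong to $D$ or have a neighbor in $D$. A set $D\subseteq V$ is isolating if $V\setminus N[D]$ is an independent set. The isolation number $\iota(G)$ is the minimum cardinality of an isolating set of $G$. Attachable graphs. Each of the following graphs has one distinguished ("circled") vertex: $P_3$, whose circled vertex is one of its leaves; $C_3$, whose circled vertex is any of its vertices; and $H_6^1, H_6^{2a}, H_6^{2b}, H_6^3$, each of which consists of an (induced) cycle $C_5$ together with a sixth vertex, the circled one, which is adjacent to, respectively, exactly one vertex of the cycle ($H_6^1$), exactly two vertices of the cycle (the two graphs $H_6^{2a}$ and $H_6^{2b}$: one in which these two vertices are adjacent in the cycle, the other in which they are not), and exactly three vertices of the cycle, which are consecutive in the cycle ($H_6^3$). The family $\mathcal{G}$ consists of all graphs obtained from a connected graph $G_0$ (with at least one vertex) by attaching at every vertex $v$ of $G_0$ exactly one copy of one of the graphs $P_3, C_3, H_6^1, H_6^{2a}, H_6^{2b}, H_6^3$, by identifying $v$ with the circled vertex of the attached copy (copies attached at different vertices are disjoint, and the choice of the attached graph may vary from vertex to vertex). *)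

theory Defs
  imports
    Complex_Main
    "Graph_Theory.Digraph_Component"
    "Graph_Theory.Digraph_Isomorphism"
begin

text \<open>
  Finite simple graphs are represented as in the Graph_Theory library: by the locales
  \<^locale>\<open>graph\<close> and \<^locale>\<open>pair_graph\<close>, that is, as finite symmetric loop-free digraphs
  without parallel arcs. The library's connectedness excludes the empty graph.
\<close>

definition closed_neighbourhood :: "('a, 'b) pre_digraph \<Rightarrow> 'a set \<Rightarrow> 'a set" where
  "closed_neighbourhood G D = {v \<in> verts G. v \<in> D \<or> (\<exists>u\<in>D. u \<rightarrow>\<^bsub>G\<^esub> v)}"

definition independent_set :: "('a, 'b) pre_digraph \<Rightarrow> 'a set \<Rightarrow> bool" where
  "independent_set G S \<longleftrightarrow> S \<subseteq> verts G \<and> (\<forall>u\<in>S. \<forall>v\<in>S. \<not> u \<rightarrow>\<^bsub>G\<^esub> v)"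

definition isolating_set :: "('a, 'b) pre_digraph \<Rightarrow> 'a set \<Rightarrow> bool" where
  "isolating_set G D \<longleftrightarrow>
     D \<subseteq> verts G \<and> independent_set G (verts G - closed_neighbourhood G D)"

definition isolation_number :: "('a, 'b) pre_digraph \<Rightarrow> nat" where
  "isolation_number G = Min (card ` {D. isolating_set G D})"

definition path_graph :: "nat \<Rightarrow> nat pair_pre_digraph" where
  "path_graph k = \<lparr> pverts = {..<k},
     parcs = {(i, j). i < k \<and> j < k \<and> (j = Suc i \<or> i = Suc j)} \<rparr>"

text \<open>Only meaningful for \<^term>\<open>k \<ge> 3\<close>.\<close>

definition cycle_graph :: "nat \<Rightarrow> nat pair_pre_digraph" where
  "cycle_graph k = \<lparr> pverts = {..<k},
     parcs = {(i, j). i < k \<and> j < k \<and> (j = Suc i mod k \<or> i = Suc j mod k)} \<rparr>"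

text \<open>The cycle on the vertices 0, ..., 4 with a sixth vertex 5 whose neighbours are those in \<^term>\<open>S\<close>.\<close>

definition C5_plus_vertex :: "nat set \<Rightarrow> nat pair_pre_digraph" where
  "C5_plus_vertex S = \<lparr> pverts = insert 5 (pverts (cycle_graph 5)),
     parcs = parcs (cycle_graph 5) \<union> {5} \<times> S \<union> S \<times> {5} \<rparr>"

datatype attachable = P3 | C3 | H6_1 | H6_2a | H6_2b | H6_3

primrec attachable_graph :: "attachable \<Rightarrow> nat pair_pre_digraph" where
  "attachable_graph P3 = path_graph 3"
| "attachable_graph C3 = cycle_graph 3"
| "attachable_graph H6_1 = C5_plus_vertex {0}"
| "attachable_graph H6_2a = C5_plus_vertex {0, 1}"
| "attachable_graph H6_2b = C5_plus_vertex {0, 2}"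
| "attachable_graph H6_3 = C5_plus_vertex {0, 1, 2}"

primrec circled :: "attachable \<Rightarrow> nat" where
  "circled P3 = 0"
| "circled C3 = 0"
| "circled H6_1 = 5"
| "circled H6_2a = 5"
| "circled H6_2b = 5"
| "circled H6_3 = 5"

text \<open>
  The copy of \<^term>\<open>attachable_graph (f v)\<close> attached at \<^term>\<open>v\<close> has the vertices \<open>(v, i)\<close>;
  the vertex \<^term>\<open>v\<close> of \<^term>\<open>G\<^sub>0\<close> itself becomes \<^term>\<open>(v, circled (f v))\<close>.
\<close>

definition attach ::
  "'v pair_pre_digraph \<Rightarrow> ('v \<Rightarrow> attachable) \<Rightarrow> ('v \<times> nat) pair_pre_digraph" where
  "attach G\<^sub>0 f = \<lparr>
     pverts = (SIGMA v : pverts G\<^sub>0. pverts (attachable_graph (f v))),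
     parcs =
       {((u, circled (f u)), (v, circled (f v))) | u v. (u, v) \<in> parcs G\<^sub>0} \<union>
       {((v, i), (v, j)) | v i j. v \<in> pverts G\<^sub>0 \<and> (i, j) \<in> parcs (attachable_graph (f v))} \<rparr>"

text \<open>
  Membership is up to isomorphism, so it is no restriction to take the vertices of the finite
  graph \<^term>\<open>G\<^sub>0\<close> from the natural numbers.
\<close>

definition family_G :: "('a, 'b) pre_digraph set" where
  "family_G = {G. \<exists>(G\<^sub>0 :: nat pair_pre_digraph) f.
     pair_graph G\<^sub>0 \<and> Digraph_Component.connected (with_proj G\<^sub>0) \<and>
     digraph_iso (with_proj (attach G\<^sub>0 f)) G}"

end

theory Submission
  imports Defs
begin

text \<open>
  Every attachable graph \<open>A\<close> has a dominating set of size \<open>|A|/3\<close>, and the union of such sets over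
  all attached copies dominates \<open>G\<close>. Conversely, only the circled vertex of a copy has neighbours
  outside it, so the trace of an isolating set on a copy has to meet the closed neighbourhood of
  every edge avoiding the circled vertex, and already this forces the trace to have size at least
  \<open>|A|/3\<close>: one vertex dominates at most three consecutive vertices of a 5-cycle.
\<close>

section \<open>The isolation number: isomorphism invariance and a minimality criterion\<close>

lemma isolation_number_app_iso:
  assumes iso: "pre_digraph.digraph_isomorphism G h"
  shows "isolation_number (app_iso h G) = isolation_number G"
proof -
  let ?H = "app_iso h G" and ?f = "iso_verts h"
  interpret wf_digraph G
    using iso by (simp add: pre_digraph.digraph_isomorphism_def)
  have inj: "inj_on ?f (verts G)"
    using iso by (rule digraph_isomorphism_inj_on_verts)
  have in_verts: "u \<in> verts G \<and> v \<in> verts G" if "u \<rightarrow>\<^bsub>G\<^esub> v" for u v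
    using that by (auto simp: arcs_ends_conv)
  have arcs_iff: "?f u \<rightarrow>\<^bsub>?H\<^esub> ?f v \<longleftrightarrow> u \<rightarrow>\<^bsub>G\<^esub> v" if "u \<in> verts G" "v \<in> verts G" for u v
  proof -
    \<comment> \<open>An arc of \<open>?H\<close> is the image of some arc \<open>u'\<close> to
      \<open>v'\<close> of \<open>G\<close>. Since \<open>?f\<close> is injective only on
      \<open>verts G\<close>, the ends of that arc must be known to lie there before they can be
      identified with \<open>u\<close> and \<open>v\<close>.\<close>
    have "u = u' \<and> v = v'" if "?f u = ?f u'" "?f v = ?f v'" "u' \<rightarrow>\<^bsub>G\<^esub> v'" for u' v'
      using inj in_verts[OF that(3)] \<open>u \<in> verts G\<close> \<open>v \<in> verts G\<close> that(1,2) by (auto dest: inj_onD)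
    then show ?thesis
      unfolding arcs_ends_app_iso_eq[OF iso] by force
  qed
  have isolating_iff: "isolating_set ?H (?f ` D) \<longleftrightarrow> isolating_set G D" if "D \<subseteq> verts G" for D
  proof -
    have "closed_neighbourhood ?H (?f ` D) = ?f ` closed_neighbourhood G D"
      using that inj arcs_iff unfolding closed_neighbourhood_def
      by (auto simp: inj_on_image_mem_iff subset_iff)
    moreover have "closed_neighbourhood G D \<subseteq> verts G"
      by (auto simp: closed_neighbourhood_def)
    ultimately have "verts ?H - closed_neighbourhood ?H (?f ` D)
        = ?f ` (verts G - closed_neighbourhood G D)"
      using inj by (simp add: inj_on_image_set_diff)
    then show ?thesis
      using that arcs_iff by (auto simp: isolating_set_def independent_set_def)
  qed
  \<comment> \<open>Taking images matches the isolating sets of the two graphs and preserves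
    cardinality, so both minima range over the same set of numbers.\<close>
  have "{D. isolating_set ?H D} = (`) ?f ` {D. isolating_set G D}"
  proof (intro set_eqI iffI)
    fix D assume D: "D \<in> {D. isolating_set ?H D}"
    then have "D \<subseteq> ?f ` verts G" by (auto simp: isolating_set_def)
    then obtain D' where "D' \<subseteq> verts G" "D = ?f ` D'" by (auto simp: subset_image_iff)
    with D isolating_iff show "D \<in> (`) ?f ` {D. isolating_set G D}" by blast
  next
    fix D assume "D \<in> (`) ?f ` {D. isolating_set G D}"
    then show "D \<in> {D. isolating_set ?H D}"
      using isolating_iff by (auto simp: isolating_set_def)
  qed
  moreover have "card (?f ` D) = card D" if "isolating_set G D" for D
    using that inj by (auto simp: isolating_set_def intro: card_image inj_on_subset)
  ultimately show ?thesis
    by (simp add: isolation_number_def image_image cong: image_cong_simp)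
qed

lemma isolation_number_eqI:
  assumes "finite (verts G)" and "isolating_set G D"
    and "\<And>D'. isolating_set G D' \<Longrightarrow> card D \<le> card D'"
  shows "isolation_number G = card D"
proof -
  have "{D. isolating_set G D} \<subseteq> Pow (verts G)" by (auto simp: isolating_set_def)
  then have "finite {D. isolating_set G D}"
    using assms(1) by (meson finite_Pow_iff finite_subset)
  then show ?thesis
    using assms(2,3) by (auto simp: isolation_number_def intro!: Min_eqI)
qed

section \<open>Dominating and isolating sets in the attachable graphs\<close>

lemma lessThan_3: "{..<3::nat} = {0, 1, 2}"
  by auto

lemma lessThan_5: "{..<5::nat} = {0, 1, 2, 3, 4}"
  by auto

lemma pverts_path_graph_3: "pverts (path_graph 3) = {0, 1, 2}"
  by (simp add: path_graph_def lessThan_3)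

lemma pverts_cycle_graph_3: "pverts (cycle_graph 3) = {0, 1, 2}"
  by (simp add: cycle_graph_def lessThan_3)

lemma pverts_C5_plus_vertex: "pverts (C5_plus_vertex S) = {0, 1, 2, 3, 4, 5}"
  by (auto simp: C5_plus_vertex_def cycle_graph_def lessThan_5)

lemmas pverts_attachable =
  pverts_path_graph_3 pverts_cycle_graph_3 pverts_C5_plus_vertex

lemma parcs_C5_plus_vertex_iff:
  "(i, j) \<in> parcs (C5_plus_vertex S) \<longleftrightarrow>
    i < 5 \<and> j < 5 \<and> (j = Suc i mod 5 \<or> i = Suc j mod 5) \<or> i = 5 \<and> j \<in> S \<or> i \<in> S \<and> j = 5"
  by (auto simp: C5_plus_vertex_def cycle_graph_def)

lemma finite_pverts_attachable: "finite (pverts (attachable_graph a))"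
  by (cases a) (simp_all add: pverts_attachable)

lemma parcs_attachable_subset:
  "parcs (attachable_graph a) \<subseteq> pverts (attachable_graph a) \<times> pverts (attachable_graph a)"
  by (cases a) (auto simp: path_graph_def cycle_graph_def C5_plus_vertex_def)

text \<open>On the cycle, 0 dominates 4, 0, 1 and 2 dominates 1, 2, 3; the sixth vertex is reached
  from 0. All four neighbour sets in \<open>attachable_graph\<close> contain 0.\<close>

lemma C5_plus_vertex_dominating:
  assumes "0 \<in> S"
  shows "closed_neighbourhood (C5_plus_vertex S) {0, 2} = pverts (C5_plus_vertex S)"
  using assms
  by (auto simp: closed_neighbourhood_def pverts_C5_plus_vertex parcs_C5_plus_vertex_iff)

lemma attachable_dominating:
  "\<exists>D \<subseteq> pverts (attachable_graph a).
    closed_neighbourhood (attachable_graph a) D = pverts (attachable_graph a) \<and>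
    card (pverts (attachable_graph a)) = 3 * card D"
proof -
  \<comment> \<open>The middle vertex of the path, a vertex of the triangle, and the pair from
    \<open>C5_plus_vertex_dominating\<close> for the four graphs of order 6.\<close>
  let ?D = "case a of P3 \<Rightarrow> {1 :: nat} | C3 \<Rightarrow> {0} | _ \<Rightarrow> {0, 2}"
  show ?thesis
  proof (intro exI conjI)
    show "?D \<subseteq> pverts (attachable_graph a)"
      by (cases a) (simp_all add: pverts_attachable)
    show "closed_neighbourhood (attachable_graph a) ?D = pverts (attachable_graph a)"
    proof (cases a)
      case P3
      then show ?thesis
        by (auto simp: closed_neighbourhood_def path_graph_def)
    next
      case C3
      then show ?thesis
        by (auto simp: closed_neighbourhood_def cycle_graph_def lessThan_3)
    qed (simp_all add: C5_plus_vertex_dominating)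
    show "card (pverts (attachable_graph a)) = 3 * card ?D"
      by (cases a) (simp_all add: pverts_attachable)
  qed
qed

text \<open>A cycle vertex \<open>x\<close> misses the two cycle vertices at distance 2 from it, and
  these are adjacent. The sixth vertex dominates only \<open>S\<close> on the cycle, so it misses
  the edge between 3 and 4; this is where the bound on \<open>S\<close> enters.\<close>

lemma C5_plus_vertex_undominated_edge:
  assumes "S \<subseteq> {0, 1, 2}" and "x < 6"
  obtains i j where "(i, j) \<in> parcs (C5_plus_vertex S)" "i \<noteq> 5" "j \<noteq> 5"
    "i \<notin> closed_neighbourhood (C5_plus_vertex S) {x}"
    "j \<notin> closed_neighbourhood (C5_plus_vertex S) {x}"
proof
  let ?i = "if x = 5 then 3 else (x + 2) mod 5" and ?j = "if x = 5 then 4 else (x + 3) mod 5"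
  have "x = 0 \<or> x = 1 \<or> x = 2 \<or> x = 3 \<or> x = 4 \<or> x = 5"
    using assms(2) by linarith
  then show "(?i, ?j) \<in> parcs (C5_plus_vertex S)" "?i \<noteq> 5" "?j \<noteq> 5"
    "?i \<notin> closed_neighbourhood (C5_plus_vertex S) {x}"
    "?j \<notin> closed_neighbourhood (C5_plus_vertex S) {x}"
    using assms(1)
    by (auto simp: closed_neighbourhood_def parcs_C5_plus_vertex_iff)
qed

lemma closed_neighbourhood_mono:
  "D \<subseteq> D' \<Longrightarrow> closed_neighbourhood G D \<subseteq> closed_neighbourhood G D'"
  by (auto simp: closed_neighbourhood_def)

lemma C5_plus_vertex_isolating_card:
  assumes S: "S \<subseteq> {0, 1, 2}" and D: "D \<subseteq> pverts (C5_plus_vertex S)"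
    and isolating: "\<And>i j. (i, j) \<in> parcs (C5_plus_vertex S) \<Longrightarrow> i \<noteq> 5 \<Longrightarrow> j \<noteq> 5 \<Longrightarrow>
      i \<in> closed_neighbourhood (C5_plus_vertex S) D \<or> j \<in> closed_neighbourhood (C5_plus_vertex S) D"
  shows "2 \<le> card D"
proof (rule ccontr)
  assume "\<not> 2 \<le> card D"
  moreover have "finite D"
    using D by (rule finite_subset) (simp add: pverts_C5_plus_vertex)
  ultimately have "D = {} \<or> (\<exists>x. D = {x})"
    by (auto simp: not_le less_2_cases_iff card_1_singleton_iff)
  moreover have "D \<subseteq> {..<6}"
    using D by (auto simp: pverts_C5_plus_vertex)
  \<comment> \<open>Enclosing \<open>D\<close> in a singleton treats the empty set and the
    one-element sets together, because enlarging \<open>D\<close> only enlarges its closed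
    neighbourhood.\<close>
  ultimately obtain x where x: "x < 6" "D \<subseteq> {x}"
    by fastforce
  obtain i j where "(i, j) \<in> parcs (C5_plus_vertex S)" "i \<noteq> 5" "j \<noteq> 5"
    "i \<notin> closed_neighbourhood (C5_plus_vertex S) {x}"
    "j \<notin> closed_neighbourhood (C5_plus_vertex S) {x}"
    using C5_plus_vertex_undominated_edge[OF S x(1)] .
  then show False
    using isolating closed_neighbourhood_mono[OF x(2)] by blast
qed

text \<open>Only edges avoiding the circled vertex are constrained, since inside
  \<open>attach\<close> the circled vertex may be dominated from another copy. The bound is
  therefore available for the trace of an isolating set on a single copy.\<close>

lemma attachable_isolating_card:
  assumes D: "D \<subseteq> pverts (attachable_graph a)"
    and isolating: "\<And>i j. (i, j) \<in> parcs (attachable_graph a) \<Longrightarrow> i \<noteq> circled a \<Longrightarrow> j \<noteq> circled a \<Longrightarrow>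
      i \<in> closed_neighbourhood (attachable_graph a) D \<or> j \<in> closed_neighbourhood (attachable_graph a) D"
  shows "card (pverts (attachable_graph a)) \<le> 3 * card D"
proof -
  have "finite D"
    using D finite_pverts_attachable by (rule finite_subset)
  \<comment> \<open>This serves \<open>P3\<close> and \<open>C3\<close>: the edge between 1 and 2
    avoids the circled vertex 0, and the empty set dominates neither end.\<close>
  have nonempty: "1 \<le> card D" if "(1, 2) \<in> parcs (attachable_graph a)" "circled a = 0"
  proof -
    have "D \<noteq> {}"
      using isolating[OF that(1)] that(2) by (auto simp: closed_neighbourhood_def)
    then show ?thesis
      using \<open>finite D\<close> by (simp add: Suc_le_eq card_gt_0_iff)
  qed
  show ?thesis
  proof (cases a)
    case P3
    then show ?thesis
      using nonempty by (simp add: pverts_attachable) (simp add: path_graph_def)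
  next
    case C3
    then show ?thesis
      using nonempty by (simp add: pverts_attachable) (simp add: cycle_graph_def)
  next
    case H6_1
    then show ?thesis
      using C5_plus_vertex_isolating_card[of "{0}" D] D isolating
      by (simp add: pverts_attachable)
  next
    case H6_2a
    then show ?thesis
      using C5_plus_vertex_isolating_card[of "{0, 1}" D] D isolating
      by (simp add: pverts_attachable)
  next
    case H6_2b
    then show ?thesis
      using C5_plus_vertex_isolating_card[of "{0, 2}" D] D isolating
      by (simp add: pverts_attachable)
  next
    case H6_3
    then show ?thesis
      using C5_plus_vertex_isolating_card[of "{0, 1, 2}" D] D isolating
      by (simp add: pverts_attachable)
  qed
qed

section \<open>From single copies to the whole attached graph\<close>

lemma card_pverts_attach:
  assumes "finite (pverts G\<^sub>0)"
  shows "card (pverts (attach G\<^sub>0 f)) = (\<Sum>v\<in>pverts G\<^sub>0. card (pverts (attachable_graph (f v))))"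
  using assms by (simp add: attach_def finite_pverts_attachable)

lemma attach_isolating:
  assumes fin: "finite (pverts G\<^sub>0)"
  obtains D where "isolating_set (attach G\<^sub>0 f) D" and "card (pverts (attach G\<^sub>0 f)) = 3 * card D"
proof -
  \<comment> \<open>One dominating set is fixed per kind of attachable graph and reused in every
    copy of that kind.\<close>
  obtain d where d: "d a \<subseteq> pverts (attachable_graph a)"
    "closed_neighbourhood (attachable_graph a) (d a) = pverts (attachable_graph a)"
    "card (pverts (attachable_graph a)) = 3 * card (d a)" for a
    using attachable_dominating by metis
  let ?D = "SIGMA v : pverts G\<^sub>0. d (f v)"
  have "(v, i) \<in> closed_neighbourhood (attach G\<^sub>0 f) ?D"
    if "v \<in> pverts G\<^sub>0" "i \<in> pverts (attachable_graph (f v))" for v i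
  proof -
    have "i \<in> closed_neighbourhood (attachable_graph (f v)) (d (f v))"
      using that d(2) by simp
    then show ?thesis
      using that(1) by (auto simp: closed_neighbourhood_def attach_def)
  qed
  \<comment> \<open>Everything is dominated, so the set required to be independent is empty.\<close>
  then have "pverts (attach G\<^sub>0 f) - closed_neighbourhood (attach G\<^sub>0 f) ?D = {}"
    by (auto simp: attach_def)
  moreover have "?D \<subseteq> pverts (attach G\<^sub>0 f)"
    using d(1) by (auto simp: attach_def)
  ultimately have "isolating_set (attach G\<^sub>0 f) ?D"
    by (auto simp: isolating_set_def independent_set_def)
  moreover have "finite (d a)" for a
    using d(1) finite_pverts_attachable by (rule finite_subset)
  then have "card (pverts (attach G\<^sub>0 f)) = 3 * card ?D"
    using fin by (simp add: card_pverts_attach d(3) sum_distrib_left)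
  ultimately show thesis ..
qed

lemma attach_isolating_card:
  assumes fin: "finite (pverts G\<^sub>0)" and D: "isolating_set (attach G\<^sub>0 f) D"
  shows "card (pverts (attach G\<^sub>0 f)) \<le> 3 * card D"
proof -
  \<comment> \<open>\<open>E v\<close> is the trace of \<open>D\<close> on the copy at
    \<open>v\<close>; the traces partition \<open>D\<close>, so their cardinalities add up to
    \<open>card D\<close>.\<close>
  define E where "E v = {i. (v, i) \<in> D}" for v
  have sub: "D \<subseteq> pverts (attach G\<^sub>0 f)"
    using D by (simp add: isolating_set_def)
  then have D_eq: "D = (SIGMA v : pverts G\<^sub>0. E v)"
    by (auto simp: attach_def E_def)
  have E_sub: "E v \<subseteq> pverts (attachable_graph (f v))" for v
    using sub by (auto simp: attach_def E_def)
  \<comment> \<open>An arc coming from \<open>G\<^sub>0\<close> ends in a circled vertex, so any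
    other vertex can be dominated only from within its own copy.\<close>
  have local: "i \<in> closed_neighbourhood (attachable_graph (f v)) (E v)"
    if "(v, i) \<in> closed_neighbourhood (attach G\<^sub>0 f) D" "i \<noteq> circled (f v)" for v i
    using that by (auto simp: closed_neighbourhood_def attach_def E_def)
  have "card (pverts (attachable_graph (f v))) \<le> 3 * card (E v)" if v: "v \<in> pverts G\<^sub>0" for v
  proof (rule attachable_isolating_card[OF E_sub])
    fix i j
    assume ij: "(i, j) \<in> parcs (attachable_graph (f v))" "i \<noteq> circled (f v)" "j \<noteq> circled (f v)"
    have "(i, j) \<in> pverts (attachable_graph (f v)) \<times> pverts (attachable_graph (f v))"
      using parcs_attachable_subset ij(1) by blast
    then have "(v, i) \<in> pverts (attach G\<^sub>0 f)" "(v, j) \<in> pverts (attach G\<^sub>0 f)"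
      using v by (auto simp: attach_def)
    moreover have "((v, i), (v, j)) \<in> parcs (attach G\<^sub>0 f)"
      using v ij(1) by (auto simp: attach_def)
    ultimately have "(v, i) \<in> closed_neighbourhood (attach G\<^sub>0 f) D
        \<or> (v, j) \<in> closed_neighbourhood (attach G\<^sub>0 f) D"
      using D unfolding isolating_set_def independent_set_def with_proj_simps by blast
    then show "i \<in> closed_neighbourhood (attachable_graph (f v)) (E v)
        \<or> j \<in> closed_neighbourhood (attachable_graph (f v)) (E v)"
      using local ij(2,3) by blast
  qed
  then have "card (pverts (attach G\<^sub>0 f)) \<le> (\<Sum>v\<in>pverts G\<^sub>0. 3 * card (E v))"
    unfolding card_pverts_attach[OF fin] by (rule sum_mono)
  also have "\<dots> = 3 * card D"
  proof -
    have "finite (E v)" for v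
      using E_sub finite_pverts_attachable by (rule finite_subset)
    then show ?thesis
      using fin by (simp add: D_eq sum_distrib_left)
  qed
  finally show ?thesis .
qed

text \<open>The dominating set of \<open>attach_isolating\<close> attains the lower bound of
  \<open>attach_isolating_card\<close>. The factor 3 on the left keeps the equation in the natural
  numbers.\<close>

lemma isolation_number_attach:
  assumes fin: "finite (pverts G\<^sub>0)"
  shows "3 * isolation_number (attach G\<^sub>0 f) = card (pverts (attach G\<^sub>0 f))"
proof -
  obtain D where D: "isolating_set (attach G\<^sub>0 f) D" "card (pverts (attach G\<^sub>0 f)) = 3 * card D"
    using attach_isolating[OF fin] .
  have "isolation_number (attach G\<^sub>0 f) = card D"
  proof (rule isolation_number_eqI)
    show "finite (verts (attach G\<^sub>0 f))"
      using fin by (simp add: attach_def finite_pverts_attachable)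
    show "card D \<le> card D'" if "isolating_set (attach G\<^sub>0 f) D'" for D'
      using attach_isolating_card[OF fin that] D(2) by simp
  qed (fact D(1))
  then show ?thesis
    using D(2) by simp
qed

theorem proposition3:
  fixes G :: "('a, 'b) pre_digraph" and n :: nat
  assumes "graph G"
    and "card (verts G) = n"
    and "G \<in> family_G"
  shows "real (isolation_number G) = real n / 3"
proof -
  obtain G\<^sub>0 :: "nat pair_pre_digraph" and f h where "pair_graph G\<^sub>0"
    and iso: "pre_digraph.digraph_isomorphism (with_proj (attach G\<^sub>0 f)) h"
    and G: "G = app_iso h (with_proj (attach G\<^sub>0 f))"
    using assms(3) by (auto simp: family_G_def digraph_iso_def)
  interpret pair_graph G\<^sub>0 by fact
  \<comment> \<open>Both the order and the isolation number are carried over from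
    \<open>attach G\<^sub>0 f\<close> to its isomorphic image \<open>G\<close>.\<close>
  have "card (verts G) = card (pverts (attach G\<^sub>0 f))"
    using pre_digraph.digraph_isomorphism_inj_on_verts[OF iso] by (simp add: G card_image)
  moreover have "isolation_number G = isolation_number (attach G\<^sub>0 f)"
    unfolding G using iso by (rule isolation_number_app_iso)
  ultimately have "3 * isolation_number G = n"
    using isolation_number_attach[OF pair_finite_verts, of f] assms(2) by simp
  then show ?thesis by simp
qed

end
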